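(* Let $E$ be a nonzero reflexive real Banach space, let $f,g\colon E\times E^*\to\,]{-}\infty,\infty]$ be proper convex lower semicontinuous BC--functions, and let $w^*\in E^*$ be such that $E\times\{w^*\}\subset\mathrm{dom}\,f$ and $\pi_2\,\mathrm{dom}\,g=E^*$. Then: (a) ${\cal P}_q(f)+\rho_1{\cal P}_q(g)=E\times E^*$ and ${\cal P}_q(f)-\rho_1{\cal P}_q(g)=E\times E^*$; (b) for every $x\in E$ there exist $(y,y^* )\in{\cal P}_q(f)$ and $(z,y^* )\in{\cal P}_q(g)$ with $y+z=x$; (c) for every $x^*\in E^*$ there exist $(y,y^* )\in{\cal P}_q(f)$ and $(y,z^* )\in{\cal P}_q(g)$ with $y^*+z^*=x^*$.
   Context: $\rho_1(x,x^* ):=(-x,x^* )$, $\pi_2(x,x^* ):=x^*$, $\mathrm{dom}\,f:=\{(x,x^* )\colon f(x,x^* )\in\mathbb{R}\}$. On $E\times E^*$ set $\lfloor(x,x^* ),(y,y^* )\rfloor:=\langle x,y^*\rangle+\langle y,x^*\rangle$ and $q(x,x^* ):=\langle x,x^*\rangle$. For $k$ on $E\times E^*$, $k^@(y,y^* ):=\sup_{(x,x^* )}[\lfloor(x,x^* ),(y,y^* )\rfloor-k(x,x^* )]$; a BC--function is a proper convex $k$ with $k^@\ge k\ge q$; ${\cal P}_q(k):=\{(x,x^* )\colon k(x,x^* )=\langle x,x^*\rangle\}$. *)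

theory Defs
  imports "HOL-Analysis.Analysis"
begin

definition reflexive_space :: "'a::real_normed_vector itself \<Rightarrow> bool" where
  "reflexive_space _ \<longleftrightarrow>
     (\<forall>\<Phi> :: ('a \<Rightarrow>\<^sub>L real) \<Rightarrow>\<^sub>L real. \<exists>x::'a. \<forall>xs. blinfun_apply \<Phi> xs = blinfun_apply xs x)"

definition q_fun :: "'a::real_normed_vector \<times> ('a \<Rightarrow>\<^sub>L real) \<Rightarrow> real" where
  "q_fun p = blinfun_apply (snd p) (fst p)"

definition bracket :: "'a::real_normed_vector \<times> ('a \<Rightarrow>\<^sub>L real) \<Rightarrow> 'a \<times> ('a \<Rightarrow>\<^sub>L real) \<Rightarrow> real" where
  "bracket p r = blinfun_apply (snd r) (fst p) + blinfun_apply (snd p) (fst r)"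

definition at_conj :: "('a::real_normed_vector \<times> ('a \<Rightarrow>\<^sub>L real) \<Rightarrow> ereal)
     \<Rightarrow> 'a \<times> ('a \<Rightarrow>\<^sub>L real) \<Rightarrow> ereal" where
  "at_conj k r = (SUP p. ereal (bracket p r) - k p)"

definition proper_fun :: "('b \<Rightarrow> ereal) \<Rightarrow> bool" where
  "proper_fun k \<longleftrightarrow> (\<forall>p. k p \<noteq> -\<infinity>) \<and> (\<exists>p. k p \<noteq> \<infinity>)"

definition convex_fun :: "('b::real_vector \<Rightarrow> ereal) \<Rightarrow> bool" where
  "convex_fun k \<longleftrightarrow> (\<forall>x y u. 0 < u \<and> u < 1 \<longrightarrow>
      k (u *\<^sub>R x + (1 - u) *\<^sub>R y) \<le> ereal u * k x + ereal (1 - u) * k y)"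

definition lsc_fun :: "('b::topological_space \<Rightarrow> ereal) \<Rightarrow> bool" where
  "lsc_fun k \<longleftrightarrow> (\<forall>c::real. closed {p. k p \<le> ereal c})"

definition BC_fun :: "('a::real_normed_vector \<times> ('a \<Rightarrow>\<^sub>L real) \<Rightarrow> ereal) \<Rightarrow> bool" where
  "BC_fun k \<longleftrightarrow> proper_fun k \<and> convex_fun k \<and>
      (\<forall>p. ereal (q_fun p) \<le> k p \<and> k p \<le> at_conj k p)"

definition Pq :: "('a::real_normed_vector \<times> ('a \<Rightarrow>\<^sub>L real) \<Rightarrow> ereal) \<Rightarrow> ('a \<times> ('a \<Rightarrow>\<^sub>L real)) set" where
  "Pq k = {p. k p = ereal (q_fun p)}"

definition dom_fun :: "('b \<Rightarrow> ereal) \<Rightarrow> 'b set" where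
  "dom_fun k = {p. k p \<noteq> \<infinity> \<and> k p \<noteq> -\<infinity>}"

definition rho1 :: "'a::real_normed_vector \<times> 'b \<Rightarrow> 'a \<times> 'b" where
  "rho1 p = (- fst p, snd p)"

end

theory Submission
  imports Defs
begin

text \<open>Let \<open>s\<close> be one of the maps \<open>(x, xs) \<mapsto> (x, - xs)\<close> and \<open>(x, xs) \<mapsto> (- x, xs)\<close>, so that
  \<open>q_fun \<circ> s = - q_fun\<close>. For fixed \<open>u\<close>, \<open>f p + g (s (p - u)) \<ge> q_fun p - q_fun (p - u)\<close>, and the
  right-hand side is affine in \<open>p\<close>. By the assumptions on the domains, every vector is a difference of
  points of the domains of the two summands, so Fenchel duality provides a continuous linear functional
  separating them, which by reflexivity is \<open>\<lambda>p. bracket p z\<close> for some \<open>z\<close>. The inequalities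
  \<open>q_fun \<le> f \<le> at_conj f\<close> at \<open>z + u\<close> and \<open>q_fun \<le> g \<le> at_conj g\<close> at \<open>s z\<close> then become equalities,
  and \<open>u = (z + u) - z\<close> with \<open>z = - rho1 (s z)\<close> or \<open>z = rho1 (s z)\<close> is the required decomposition.

  The separating functional comes from the Hahn--Banach theorem. Its continuity is an open mapping
  argument: the sets of differences of points of norm at most \<open>n\<close> in the sublevel sets at height \<open>n\<close>
  cover the space, so by Baire one of them is dense in a ball, and dyadic series in a closed
  convex bounded set remove the closure.\<close>

subsection \<open>Linear functionals below convex functions\<close>

definition sublinear :: "('a::real_vector \<Rightarrow> real) \<Rightarrow> bool" where
  "sublinear p \<longleftrightarrow> (\<forall>x y. p (x + y) \<le> p x + p y) \<and> (\<forall>c x. 0 < c \<longrightarrow> p (c *\<^sub>R x) = c * p x)"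

text \<open>Applying the homogeneity inequality to \<open>inverse c\<close> at the point
  \<open>c *\<^sub>R x\<close> gives its reverse, so one direction suffices.\<close>

lemma sublinearI:
  assumes "\<And>x y. p (x + y) \<le> p x + p y" and "\<And>c x. 0 < c \<Longrightarrow> p (c *\<^sub>R x) \<le> c * p x"
  shows "sublinear p"
proof -
  have "c * p x \<le> p (c *\<^sub>R x)" if "0 < c" for c x
    using assms(2)[of "inverse c" "c *\<^sub>R x"] that by (simp add: field_simps)
  then show ?thesis
    using assms by (auto simp: sublinear_def intro: antisym)
qed

lemma sublinear_zero:
  assumes "sublinear p"
  shows "p 0 = 0"
proof -
  have "p (2 *\<^sub>R 0) = 2 * p 0" using assms unfolding sublinear_def by (meson zero_less_numeral)
  then show ?thesis by simp
qed

lemma sublinear_minus: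
  assumes "sublinear p"
  shows "- p (- x) \<le> p x"
proof -
  have "p (x + - x) \<le> p x + p (- x)" using assms unfolding sublinear_def by blast
  then show ?thesis using sublinear_zero[OF assms] by simp
qed

text \<open>Taking the infimum over one variable at a time separates the two. This yields
  subadditivity for each functional below that is defined as an infimum.\<close>

lemma le_cINF_add:
  fixes f :: "'b \<Rightarrow> real" and g :: "'c \<Rightarrow> real"
  assumes "A \<noteq> {}" "B \<noteq> {}" and "\<And>a b. a \<in> A \<Longrightarrow> b \<in> B \<Longrightarrow> v \<le> f a + g b"
  shows "v \<le> Inf (f ` A) + Inf (g ` B)"
proof -
  have "v - Inf (f ` A) \<le> g b" if "b \<in> B" for b
  proof -
    have "v - g b \<le> Inf (f ` A)"
      using assms that by (intro cINF_greatest) (auto simp: algebra_simps)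
    then show ?thesis by simp
  qed
  then have "v - Inf (f ` A) \<le> Inf (g ` B)"
    using assms by (intro cINF_greatest) auto
  then show ?thesis by simp
qed

text \<open>Take for \<open>q'\<close> the infimum over \<open>t \<ge> 0\<close> of
  \<open>q (x + t *\<^sub>R y) - t * q y\<close>. The value \<open>t = 0\<close> gives
  \<open>q' \<le> q\<close>, and \<open>t = 1\<close> at the point \<open>- y\<close> gives the
  bound in the chosen direction.\<close>

lemma sublinear_lower_in_direction:
  assumes q: "sublinear q"
  obtains q' where "sublinear q'" "\<And>x. q' x \<le> q x" "q' (- y) \<le> - q y"
proof -
  have add: "q (u + v) \<le> q u + q v" and hom: "0 < c \<Longrightarrow> q (c *\<^sub>R u) = c * q u" for u v c
    using q by (auto simp: sublinear_def)
  have hom0: "q (c *\<^sub>R u) = c * q u" if "0 \<le> c" for u c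
    using hom[of c u] sublinear_zero[OF q] that by (cases "c = 0") auto
  define h where "h x t = q (x + t *\<^sub>R y) - t * q y" for x t
  define q' where "q' x = Inf (h x ` {0..})" for x
  have bdd: "bdd_below (h x ` {0..})" for x
  proof (rule bdd_belowI2)
    fix t :: real assume "t \<in> {0..}"
    then show "- q (- x) \<le> h x t"
      using add[of "x + t *\<^sub>R y" "- x"] hom0[of t y] by (simp add: h_def)
  qed
  have lower: "q' x \<le> h x t" if "0 \<le> t" for x t
    unfolding q'_def using that by (intro cINF_lower bdd) auto
  have "sublinear q'"
  proof (rule sublinearI)
    fix x z
    have "q' (x + z) \<le> h x s + h z t" if "0 \<le> s" "0 \<le> t" for s t
    proof -
      have "q' (x + z) \<le> h (x + z) (s + t)" using that by (intro lower) auto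
      also have "\<dots> \<le> h x s + h z t"
        using add[of "x + s *\<^sub>R y" "z + t *\<^sub>R y"] by (simp add: h_def algebra_simps)
      finally show ?thesis .
    qed
    then show "q' (x + z) \<le> q' x + q' z"
      unfolding q'_def[of x] q'_def[of z] by (intro le_cINF_add) auto
  next
    fix c :: real and x assume c: "0 < c"
    have "q' (c *\<^sub>R x) / c \<le> h x t" if "t \<in> {0..}" for t
    proof -
      have "q' (c *\<^sub>R x) \<le> h (c *\<^sub>R x) (c * t)" using that c by (intro lower) auto
      also have "\<dots> = c * h x t"
        using hom[OF c, of "x + t *\<^sub>R y"] by (simp add: h_def algebra_simps)
      finally show ?thesis using c by (simp add: field_simps)
    qed
    then have "q' (c *\<^sub>R x) / c \<le> q' x"
      unfolding q'_def[of x] by (intro cINF_greatest) auto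
    then show "q' (c *\<^sub>R x) \<le> c * q' x" using c by (simp add: field_simps)
  qed
  moreover have "q' x \<le> q x" for x using lower[of 0 x] by (simp add: h_def)
  moreover have "q' (- y) \<le> - q y"
    using lower[of 1 "- y"] sublinear_zero[OF q] by (simp add: h_def)
  ultimately show thesis by (rule that)
qed

text \<open>The values at \<open>x\<close> stay above \<open>- p (- x)\<close>, so the infimum is
  finite. It is subadditive because the smaller of two members of the chain can be used at both
  points.\<close>

lemma sublinear_Inf_chain:
  assumes "C \<noteq> {}" and sub: "\<And>q. q \<in> C \<Longrightarrow> sublinear q" and le: "\<And>q x. q \<in> C \<Longrightarrow> q x \<le> p x"
    and chain: "\<And>q q'. q \<in> C \<Longrightarrow> q' \<in> C \<Longrightarrow> q \<le> q' \<or> q' \<le> q"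
  defines "u \<equiv> \<lambda>x. INF q\<in>C. q x"
  shows "sublinear u" and "\<And>q. q \<in> C \<Longrightarrow> u \<le> q"
proof -
  have bdd: "bdd_below ((\<lambda>q. q x) ` C)" for x
  proof (rule bdd_belowI2)
    fix q assume "q \<in> C"
    then show "- p (- x) \<le> q x"
      using sublinear_minus[OF sub, of q x] le[of q "- x"] by simp
  qed
  have lower: "u x \<le> q x" if "q \<in> C" for q x
    unfolding u_def using that by (intro cINF_lower bdd) auto
  then show "\<And>q. q \<in> C \<Longrightarrow> u \<le> q" by (simp add: le_fun_def)
  show "sublinear u"
  proof (rule sublinearI)
    fix x y
    have "u (x + y) \<le> q x + q' y" if "q \<in> C" "q' \<in> C" for q q'
    proof -
      have *: "u (x + y) \<le> r x + r y" if "r \<in> C" for r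
        using lower[OF that, of "x + y"] sub[OF that] by (meson order_trans sublinear_def)
      show ?thesis
        using chain[OF that]
      proof
        assume "q \<le> q'"
        then show ?thesis using *[OF that(1)] le_funD[of q q' y] by linarith
      next
        assume "q' \<le> q"
        then show ?thesis using *[OF that(2)] le_funD[of q' q x] by linarith
      qed
    qed
    then show "u (x + y) \<le> u x + u y"
      unfolding u_def using \<open>C \<noteq> {}\<close> by (intro le_cINF_add)
  next
    fix c :: real and x assume c: "0 < c"
    have "u (c *\<^sub>R x) / c \<le> q x" if "q \<in> C" for q
      using lower[OF that, of "c *\<^sub>R x"] sub[OF that] c by (simp add: sublinear_def field_simps)
    then have "u (c *\<^sub>R x) / c \<le> (INF q\<in>C. q x)"
      using \<open>C \<noteq> {}\<close> by (intro cINF_greatest) auto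
    then show "u (c *\<^sub>R x) \<le> c * u x" using c by (simp add: u_def field_simps)
  qed
qed

text \<open>A minimal sublinear functional below \<open>p\<close> is odd, since otherwise it could be lowered in some
  direction; an odd sublinear functional is linear.\<close>
theorem sublinear_dominates_linear:
  assumes p: "sublinear p"
  shows "\<exists>L. linear L \<and> (\<forall>x. L x \<le> p x)"
proof -
  define A where "A = {q. sublinear q \<and> q \<le> p}"
  have "\<exists>m\<in>A. \<forall>a\<in>A. a \<le> m \<longrightarrow> a = m"
  \<comment> \<open>The order is reversed, so the maximal element that Zorn's lemma yields is a
    minimal sublinear functional.\<close>
  proof (rule predicate_Zorn[where P = "\<lambda>a b. b \<le> a"])
    show "partial_order_on A (relation_of (\<lambda>a b. b \<le> a) A)"
      by (rule partial_order_on_relation_ofI) auto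
    fix C assume "C \<in> Chains (relation_of (\<lambda>a b. b \<le> a) A)"
    then have CA: "C \<subseteq> A" and chain: "\<And>q q'. q \<in> C \<Longrightarrow> q' \<in> C \<Longrightarrow> q \<le> q' \<or> q' \<le> q"
      by (auto simp: Chains_def relation_of_def)
    show "\<exists>u\<in>A. \<forall>a\<in>C. u \<le> a"
    proof (cases "C = {}")
      case True
      then show ?thesis using p by (auto simp: A_def)
    next
      case False
      note u = sublinear_Inf_chain[OF False, of p]
      have *: "sublinear (\<lambda>x. INF q\<in>C. q x)" "\<And>q. q \<in> C \<Longrightarrow> (\<lambda>x. INF q\<in>C. q x) \<le> q"
        using CA chain by (intro u; auto simp: A_def le_fun_def)+
      moreover obtain q where "q \<in> C" using False by blast
      then have "q \<le> p" using CA by (auto simp: A_def)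
      then have "(\<lambda>x. INF q\<in>C. q x) \<le> p" using *(2)[OF \<open>q \<in> C\<close>] by (rule order_trans[rotated])
      ultimately show ?thesis by (intro bexI[of _ "\<lambda>x. INF q\<in>C. q x"]) (auto simp: A_def)
    qed
  qed
  then obtain m where m: "sublinear m" "m \<le> p" and min: "\<And>a. sublinear a \<Longrightarrow> a \<le> m \<Longrightarrow> a = m"
    unfolding A_def by (blast intro: order_trans)
  have odd: "m (- y) = - m y" for y
  proof -
    obtain q where "sublinear q" "\<And>x. q x \<le> m x" "q (- y) \<le> - m y"
      using sublinear_lower_in_direction[OF m(1), of y] by blast
    then have "m (- y) \<le> - m y" using min[of q] by (simp add: le_fun_def)
    then show ?thesis using sublinear_minus[OF m(1), of y] by simp
  qed
  have add: "m (u + v) \<le> m u + m v" and hom: "0 < c \<Longrightarrow> m (c *\<^sub>R u) = c * m u" for u v c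
    using m by (auto simp: sublinear_def)
  have "linear m"
  proof (rule linearI)
    fix x y
    show "m (x + y) = m x + m y"
      using add[of x y] add[of "- x" "- y"] odd[of x] odd[of y] odd[of "x + y"] by simp
  next
    fix c x
    show "m (c *\<^sub>R x) = c *\<^sub>R m x"
      using hom[of c x] hom[of "- c" x] odd[of "c *\<^sub>R x"] sublinear_zero[OF m(1)]
      by (cases c "0::real" rule: linorder_cases) auto
  qed
  then show ?thesis using m(2) by (auto simp: le_fun_def)
qed

text \<open>The infimum \<open>p u\<close> of \<open>r / t\<close> over \<open>t > 0\<close> with
  \<open>(t *\<^sub>R u, r)\<close> in \<open>S\<close> is the positively homogeneous hull of the
  function with epigraph \<open>S\<close>. Convexity makes it sublinear, and any linear functional
  below it lies below \<open>S\<close>.\<close>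

lemma linear_below_convex_epigraph:
  fixes S :: "('a::real_vector \<times> real) set"
  assumes "convex S" and total: "\<And>u. \<exists>r. (u, r) \<in> S" and zero: "\<And>r. (0, r) \<in> S \<Longrightarrow> 0 \<le> r"
  shows "\<exists>L. linear L \<and> (\<forall>u r. (u, r) \<in> S \<longrightarrow> L u \<le> r)"
proof -
  have conv: "(a *\<^sub>R u + b *\<^sub>R v, a * r + b * s) \<in> S"
    if "(u, r) \<in> S" "(v, s) \<in> S" "0 \<le> a" "0 \<le> b" "a + b = 1" for u v r s a b
    using convexD[OF \<open>convex S\<close> that] by simp
  define D where "D u = {(t, r). 0 < t \<and> (t *\<^sub>R u, r) \<in> S}" for u
  define p where "p u = (INF (t, r)\<in>D u. r / t)" for u
  have ne: "D u \<noteq> {}" for u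
  proof -
    obtain r where "(u, r) \<in> S" using total by blast
    then have "(1, r) \<in> D u" by (simp add: D_def)
    then show ?thesis by blast
  qed
  have bdd: "bdd_below ((\<lambda>(t, r). r / t) ` D u)" for u
  proof -
    obtain s where s: "(- u, s) \<in> S" using total by blast
    have "- s \<le> r / t" if "0 < t" "(t *\<^sub>R u, r) \<in> S" for t r
    proof -
      \<comment> \<open>The weights are chosen so that the multiples of \<open>u\<close> and
        \<open>- u\<close> cancel.\<close>
      have "(0, (r + t * s) / (1 + t)) \<in> S"
        using conv[OF that(2) s, of "1 / (1 + t)" "t / (1 + t)"] that(1)
        by (simp add: field_simps add_divide_distrib[symmetric])
      then have "0 \<le> (r + t * s) / (1 + t)" by (rule zero)
      then show ?thesis using that(1) by (simp add: field_simps zero_le_divide_iff)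
    qed
    then show ?thesis by (auto simp: D_def intro!: bdd_belowI2[of _ "- s"])
  qed
  have lower: "p u \<le> r / t" if "0 < t" "(t *\<^sub>R u, r) \<in> S" for u t r
    unfolding p_def using cINF_lower[OF bdd, of "(t, r)" u] that by (auto simp: D_def)
  have "sublinear p"
  proof (rule sublinearI)
    fix u v
    have "p (u + v) \<le> r / t + s / t'" if "(t, r) \<in> D u" "(t', s) \<in> D v" for t r t' s
    proof -
      have t: "0 < t" "0 < t'" "0 < t + t'" and S: "(t *\<^sub>R u, r) \<in> S" "(t' *\<^sub>R v, s) \<in> S"
        using that by (auto simp: D_def)
      \<comment> \<open>With weights proportional to \<open>t'\<close> and \<open>t\<close>, the
        points \<open>t *\<^sub>R u\<close> and \<open>t' *\<^sub>R v\<close> combine to one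
        multiple of \<open>u + v\<close>.\<close>
      let ?T = "t * t' / (t + t')"
      have "(?T *\<^sub>R (u + v), (t' * r + t * s) / (t + t')) \<in> S"
        using conv[OF S, of "t' / (t + t')" "t / (t + t')"] t
        by (simp add: scaleR_add_right add_divide_distrib[symmetric] mult.commute add.commute)
      then have "p (u + v) \<le> ((t' * r + t * s) / (t + t')) / ?T"
        using t by (intro lower) auto
      also have "\<dots> = r / t + s / t'"
      proof -
        have "r / t + s / t' = (t' * r + t * s) / (t * t')" using t by (simp add: field_simps)
        then show ?thesis using t(3) by simp
      qed
      finally show ?thesis .
    qed
    then show "p (u + v) \<le> p u + p v"
      unfolding p_def[of u] p_def[of v] by (intro le_cINF_add ne) auto
  next
    fix c :: real and u assume c: "0 < c"
    have "p (c *\<^sub>R u) / c \<le> r / t" if "(t, r) \<in> D u" for t r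
      using lower[of "t / c" "c *\<^sub>R u" r] that c by (simp add: D_def field_simps)
    then have "p (c *\<^sub>R u) / c \<le> p u"
      unfolding p_def[of u] by (intro cINF_greatest ne) auto
    then show "p (c *\<^sub>R u) \<le> c * p u" using c by (simp add: field_simps)
  qed
  then obtain L where "linear L" "\<And>u. L u \<le> p u"
    using sublinear_dominates_linear by blast
  moreover have "p u \<le> r" if "(u, r) \<in> S" for u r
    using lower[of 1 u r] that by simp
  ultimately show ?thesis by (blast intro: order_trans)
qed

subsection \<open>Open mapping for closed bounded convex sets\<close>

text \<open>The first \<open>n\<close> weights sum to \<open>1 - (1/2) ^ n\<close>. Giving the
  missing weight to a point of \<open>C\<close> produces a convex combination in \<open>C\<close>,
  and closedness passes to the limit.\<close>

lemma dyadic_series_in_closed_convex: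
  fixes z :: "nat \<Rightarrow> 'z::banach"
  assumes C: "closed C" "convex C" "bounded C" and z: "\<And>i. z i \<in> C"
  shows "summable (\<lambda>i. (1/2) ^ Suc i *\<^sub>R z i)" and "(\<Sum>i. (1/2) ^ Suc i *\<^sub>R z i) \<in> C"
proof -
  obtain B where B: "\<And>x. x \<in> C \<Longrightarrow> norm x \<le> B" using C(3) by (auto simp: bounded_iff)
  show summable: "summable (\<lambda>i. (1/2) ^ Suc i *\<^sub>R z i)"
  proof (rule summable_comparison_test')
    show "summable (\<lambda>i. B * (1/2) ^ Suc i)"
      by (intro summable_mult) (simp add: summable_geometric)
    show "norm ((1/2) ^ Suc i *\<^sub>R z i) \<le> B * (1/2) ^ Suc i" for i
      using mult_right_mono[OF B[OF z[of i]], of "(1/2) ^ Suc i"] by (simp add: mult.commute)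
  qed
  have partial: "(\<Sum>i<n. (1/2) ^ Suc i *\<^sub>R z i) + (1/2) ^ n *\<^sub>R c \<in> C" if "c \<in> C" for n c
    using that
  proof (induction n arbitrary: c)
    case (Suc n)
    have "(1/2) *\<^sub>R z n + (1/2) *\<^sub>R c \<in> C"
      using convexD[OF C(2) z Suc.prems, of "1/2" "1/2" n] by simp
    from Suc.IH[OF this] show ?case by (simp add: scaleR_add_right add.assoc)
  qed simp
  have "(\<lambda>n. (\<Sum>i<n. (1/2) ^ Suc i *\<^sub>R z i) + (1/2) ^ n *\<^sub>R z 0)
      \<longlonglongrightarrow> (\<Sum>i. (1/2) ^ Suc i *\<^sub>R z i) + 0 *\<^sub>R z 0"
    by (intro tendsto_intros summable_LIMSEQ summable LIMSEQ_power_zero) auto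
  then show "(\<Sum>i. (1/2) ^ Suc i *\<^sub>R z i) \<in> C"
    using closed_sequentially[OF C(1) partial[OF z[of 0]]] by (simp del: power_Suc)
qed

text \<open>Successive approximation: a point of the ball is approximated to within
  \<open>\<rho> / 2\<close> by the image of a point of \<open>C\<close>, and the doubled error lies
  in the ball again. The approximants form a dyadic series in \<open>C\<close>.\<close>

lemma half_ball_in_linear_image:
  fixes T :: "'z::banach \<Rightarrow> 'x::real_normed_vector"
  assumes T: "bounded_linear T" and C: "closed C" "convex C" "bounded C"
    and ball: "0 < \<rho>" "ball 0 \<rho> \<subseteq> closure (T ` C)"
  shows "ball 0 (\<rho> / 2) \<subseteq> T ` C"
proof
  interpret T: bounded_linear T by (rule T)
  fix u :: 'x assume u: "u \<in> ball 0 (\<rho> / 2)"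
  have "\<exists>z\<in>C. 2 *\<^sub>R (v - T z) \<in> ball 0 \<rho>" if "v \<in> ball 0 \<rho>" for v
  proof -
    have "v \<in> closure (T ` C)" using that ball(2) by blast
    moreover have "0 < \<rho> / 2" using ball(1) by simp
    ultimately have "\<exists>y\<in>T ` C. dist y v < \<rho> / 2" unfolding closure_approachable by blast
    then obtain z where "z \<in> C" "dist (T z) v < \<rho> / 2" by blast
    then show ?thesis by (intro bexI[of _ z]) (auto simp: dist_norm norm_minus_commute)
  qed
  then obtain Z where Z: "\<And>v. v \<in> ball 0 \<rho> \<Longrightarrow> Z v \<in> C"
      "\<And>v. v \<in> ball 0 \<rho> \<Longrightarrow> 2 *\<^sub>R (v - T (Z v)) \<in> ball 0 \<rho>"
    by metis
  \<comment> \<open>The dyadic weights start at 1/2, so the iteration starts at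
    \<open>2 *\<^sub>R u\<close>; this is why the radius is halved.\<close>
  define v where "v n = ((\<lambda>v. 2 *\<^sub>R (v - T (Z v))) ^^ n) (2 *\<^sub>R u)" for n
  have v0: "v 0 = 2 *\<^sub>R u" and vSuc: "v (Suc n) = 2 *\<^sub>R (v n - T (Z (v n)))" for n
    by (simp_all add: v_def)
  have v: "v n \<in> ball 0 \<rho>" for n
  proof (induction n)
    case 0
    then show ?case using u by (simp add: v0)
  next
    case (Suc n)
    then show ?case unfolding vSuc by (rule Z(2))
  qed
  define z where "z n = Z (v n)" for n
  have z: "z n \<in> C" for n using Z(1) v by (simp add: z_def)
  note series = dyadic_series_in_closed_convex[where z = z, OF C z]
  have partial: "(\<Sum>i<n. (1/2) ^ Suc i *\<^sub>R T (z i)) = u - (1/2) ^ Suc n *\<^sub>R v n" for n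
    by (induction n) (simp_all add: v0 vSuc z_def algebra_simps)
  have "(\<lambda>n. (1/2) ^ Suc n *\<^sub>R v n) \<longlonglongrightarrow> 0"
  proof (rule Lim_null_comparison)
    show "\<forall>\<^sub>F n in sequentially. norm ((1/2) ^ Suc n *\<^sub>R v n) \<le> \<rho> * (1/2) ^ Suc n"
      using v by (intro always_eventually allI) (simp add: less_imp_le)
    have "(\<lambda>n. \<rho> * (1/2) ^ Suc n) \<longlonglongrightarrow> \<rho> * 0"
      by (intro tendsto_mult tendsto_const LIMSEQ_Suc LIMSEQ_power_zero) auto
    then show "(\<lambda>n. \<rho> * (1/2) ^ Suc n) \<longlonglongrightarrow> 0" by simp
  qed
  then have "(\<lambda>n. u - (1/2) ^ Suc n *\<^sub>R v n) \<longlonglongrightarrow> u - 0"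
    by (intro tendsto_diff tendsto_const)
  then have "(\<lambda>i. (1/2) ^ Suc i *\<^sub>R T (z i)) sums u"
    unfolding sums_def partial by simp
  moreover have "(\<lambda>i. (1/2) ^ Suc i *\<^sub>R T (z i)) sums T (\<Sum>i. (1/2) ^ Suc i *\<^sub>R z i)"
    using T.sums[OF summable_sums[OF series(1)]] by (simp add: T.scaleR)
  ultimately have "u = T (\<Sum>i. (1/2) ^ Suc i *\<^sub>R z i)" by (rule sums_unique2)
  then show "u \<in> T ` C" using series(2) by blast
qed

theorem ball_in_linear_image:
  fixes T :: "'z::banach \<Rightarrow> 'x::banach" and C :: "nat \<Rightarrow> 'z set"
  assumes T: "bounded_linear T" and C: "\<And>n. closed (C n)" "\<And>n. convex (C n)" "\<And>n. bounded (C n)"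
    and "mono C" and cover: "(\<Union>n. T ` C n) = UNIV"
  obtains n \<rho> where "0 < \<rho>" "ball 0 \<rho> \<subseteq> T ` C n"
proof -
  have "\<exists>n. interior (closure (T ` C n)) \<noteq> {}"
  proof (rule ccontr)
    assume none: "\<not> ?thesis"
    have "euclidean interior_of (\<Union>n. closure (T ` C n)) = {}"
    proof (intro Baire_category_alt)
      show "closedin euclidean G \<and> euclidean interior_of G = {}"
        if "G \<in> range (\<lambda>n. closure (T ` C n))" for G
        using that none by auto
    qed (simp_all add: completely_metrizable_space_euclidean)
    moreover have "(\<Union>n. closure (T ` C n)) = UNIV"
    proof -
      have "(\<Union>n. T ` C n) \<subseteq> (\<Union>n. closure (T ` C n))" by (intro UN_mono closure_subset order_refl)
      then show ?thesis using cover by (simp add: top.extremum_unique)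
    qed
    ultimately show False by simp
  qed
  then obtain n u where "u \<in> interior (closure (T ` C n))" by blast
  then obtain r where r: "0 < r" "ball u r \<subseteq> closure (T ` C n)"
    by (auto simp: mem_interior)
  \<comment> \<open>The Baire ball is centred at \<open>u\<close>. Averaging it with
    \<open>- u\<close>, which lies in some image, moves the centre to 0; monotonicity puts both in
    one image.\<close>
  obtain m where m: "- u \<in> T ` C m" using cover by blast
  define k where "k = max m n"
  have sub: "T ` C n \<subseteq> T ` C k" "T ` C m \<subseteq> T ` C k"
    using \<open>mono C\<close> by (simp_all add: k_def image_mono monoD)
  have conv: "convex (closure (T ` C k))"
    using T C by (intro convex_closure convex_linear_image) (auto simp: bounded_linear.linear)
  have "ball 0 (r / 2) \<subseteq> closure (T ` C k)"
  proof
    fix v :: 'x assume "v \<in> ball 0 (r / 2)"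
    then have "u + 2 *\<^sub>R v \<in> ball u r" by (simp add: dist_norm)
    then have "u + 2 *\<^sub>R v \<in> closure (T ` C k)" using r(2) closure_mono[OF sub(1)] by blast
    moreover have "- u \<in> closure (T ` C k)" using m sub(2) closure_subset[of "T ` C k"] by blast
    ultimately have "(1/2) *\<^sub>R (u + 2 *\<^sub>R v) + (1/2) *\<^sub>R (- u) \<in> closure (T ` C k)"
      by (intro convexD[OF conv]) auto
    then show "v \<in> closure (T ` C k)" by (simp add: scaleR_add_right)
  qed
  then have "ball 0 (r / 2 / 2) \<subseteq> T ` C k"
    using r(1) by (intro half_ball_in_linear_image[OF T C]) auto
  then show thesis using r(1) by (intro that[of "r / 2 / 2"]) auto
qed

subsection \<open>Fenchel duality\<close>

text \<open>\<open>convex_fun\<close> concerns only weights strictly between 0 and 1, so the end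
  points are treated apart. Real heights replace extended-real values from here on.\<close>

lemma convex_epigraph:
  assumes "convex_fun k"
  shows "convex {(p, a). k p \<le> ereal a}"
proof (rule convexI, clarsimp)
  fix x y and a b u v :: real
  assume le: "k x \<le> ereal a" "k y \<le> ereal b" and uv: "0 \<le> u" "0 \<le> v" "u + v = 1"
  show "k (u *\<^sub>R x + v *\<^sub>R y) \<le> ereal (u * a + v * b)"
  proof (cases "u = 0 \<or> v = 0")
    case True
    then show ?thesis using le uv by auto
  next
    case False
    then have "k (u *\<^sub>R x + (1 - u) *\<^sub>R y) \<le> ereal u * k x + ereal (1 - u) * k y"
      using assms uv by (simp add: convex_fun_def)
    also have "\<dots> \<le> ereal u * ereal a + ereal (1 - u) * ereal b"
      using le uv by (intro add_mono ereal_mult_left_mono) auto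
    finally show ?thesis using uv by (simp add: eq_diff_eq[symmetric])
  qed
qed

lemma convex_sublevel:
  assumes "convex_fun k"
  shows "convex {p. k p \<le> ereal a}"
proof (rule convexI, clarsimp)
  fix x y and u v :: real
  assume "k x \<le> ereal a" "k y \<le> ereal a" "0 \<le> u" "0 \<le> v" "u + v = 1"
  then show "k (u *\<^sub>R x + v *\<^sub>R y) \<le> ereal a"
    using convexD[OF convex_epigraph[OF assms], of "(x, a)" "(y, a)" u v]
    by (simp add: distrib_right[symmetric])
qed

text \<open>The domains of \<open>F\<close> and \<open>H\<close> need not have interior points: it is enough that every vector
  is a difference of points of the two domains (the Attouch--Brezis qualification).\<close>
theorem fenchel_separation:
  fixes F H :: "'x::banach \<Rightarrow> ereal" and M :: "'x \<Rightarrow> real"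
  assumes F: "convex_fun F" "lsc_fun F" and H: "convex_fun H" "lsc_fun H" and M: "bounded_linear M"
    and below: "\<And>p a b. F p \<le> ereal a \<Longrightarrow> H p \<le> ereal b \<Longrightarrow> M p + c \<le> a + b"
    and domains: "\<And>v. \<exists>x y. F y \<noteq> \<infinity> \<and> H x \<noteq> \<infinity> \<and> y - x = v"
  obtains L where "bounded_linear L"
    "\<And>x y a b. F y \<le> ereal a \<Longrightarrow> H x \<le> ereal b \<Longrightarrow> L (y - x) + M y + c \<le> a + b"
proof -
  interpret M: bounded_linear M by (rule M)
  have dom: "\<exists>x y a b. F y \<le> ereal a \<and> H x \<le> ereal b \<and> y - x = v" for v
  proof -
    obtain x y where "F y \<noteq> \<infinity>" "H x \<noteq> \<infinity>" "y - x = v" using domains by blast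
    moreover have "\<exists>a. e \<le> ereal a" if "e \<noteq> \<infinity>" for e
      using that by (cases e) auto
    ultimately show ?thesis by blast
  qed
  \<comment> \<open>These are the points above the value function, which sends \<open>v\<close> to
    the infimum of \<open>F y + H x - M y - c\<close> over \<open>y - x = v\<close>. At
    \<open>v = 0\<close> its nonnegativity is the assumption \<open>below\<close>.\<close>
  define S where "S = {(y - x, a + b - M y - c) | x y a b. F y \<le> ereal a \<and> H x \<le> ereal b}"
  have "convex S"
  proof (rule convexI)
    fix s s' and u v :: real
    assume "s \<in> S" "s' \<in> S" and uv: "0 \<le> u" "0 \<le> v" "u + v = 1"
    then obtain x y a b x' y' a' b'
      where s: "s = (y - x, a + b - M y - c)" and FH: "F y \<le> ereal a" "H x \<le> ereal b"
        and s': "s' = (y' - x', a' + b' - M y' - c)" and FH': "F y' \<le> ereal a'" "H x' \<le> ereal b'"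
      unfolding S_def by blast
    have "F (u *\<^sub>R y + v *\<^sub>R y') \<le> ereal (u * a + v * a')"
      using convexD[OF convex_epigraph[OF F(1)], of "(y, a)" "(y', a')"] FH FH' uv by simp
    moreover have "H (u *\<^sub>R x + v *\<^sub>R x') \<le> ereal (u * b + v * b')"
      using convexD[OF convex_epigraph[OF H(1)], of "(x, b)" "(x', b')"] FH FH' uv by simp
    moreover have "u * c + v * c = c" using uv(3) by (simp add: distrib_right[symmetric])
    then have "u *\<^sub>R s + v *\<^sub>R s' = ((u *\<^sub>R y + v *\<^sub>R y') - (u *\<^sub>R x + v *\<^sub>R x'),
        (u * a + v * a') + (u * b + v * b') - M (u *\<^sub>R y + v *\<^sub>R y') - c)"
      by (simp add: s s' M.add M.scaleR algebra_simps)
    ultimately show "u *\<^sub>R s + v *\<^sub>R s' \<in> S" unfolding S_def by blast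
  qed
  moreover have "\<exists>r. (v, r) \<in> S" for v
    using dom[of v] unfolding S_def by blast
  moreover have "0 \<le> r" if r: "(0, r) \<in> S" for r
  proof -
    obtain x p a b where "F p \<le> ereal a" "H x \<le> ereal b" "(0, r) = (p - x, a + b - M p - c)"
      using r unfolding S_def by blast
    then show ?thesis using below[of p a b] by simp
  qed
  ultimately have "\<exists>L. linear L \<and> (\<forall>v r. (v, r) \<in> S \<longrightarrow> L v \<le> r)"
    by (rule linear_below_convex_epigraph)
  then obtain L where L: "linear L" and LS: "\<And>v r. (v, r) \<in> S \<Longrightarrow> L v \<le> r" by blast
  have le: "L (y - x) + M y + c \<le> a + b" if "F y \<le> ereal a" "H x \<le> ereal b" for x y a b
  proof -
    have "(y - x, a + b - M y - c) \<in> S" using that unfolding S_def by blast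
    then have "L (y - x) \<le> a + b - M y - c" by (rule LS)
    then show ?thesis by simp
  qed

  define C where "C n = ({y. F y \<le> ereal (real n)} \<inter> cball 0 (real n))
      \<times> ({x. H x \<le> ereal (real n)} \<inter> cball 0 (real n))" for n
  have T: "bounded_linear (\<lambda>p::'x \<times> 'x. fst p - snd p)"
    by (intro bounded_linear_sub bounded_linear_fst bounded_linear_snd)
  have "mono C"
  proof (rule monoI)
    fix m n :: nat assume "m \<le> n"
    then have "e \<le> ereal (real n)" if "e \<le> ereal (real m)" for e
      using order_trans[OF that, of "ereal (real n)"] by simp
    moreover have "cball (0::'x) (real m) \<subseteq> cball 0 (real n)" using \<open>m \<le> n\<close> by (simp add: subset_cball)
    ultimately show "C m \<le> C n" unfolding C_def by (intro Sigma_mono Int_mono) auto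
  qed
  moreover have "(\<Union>n. (\<lambda>p. fst p - snd p) ` C n) = UNIV"
  proof (intro equalityI subset_UNIV subsetI)
    fix v
    obtain x y a b where v: "F y \<le> ereal a" "H x \<le> ereal b" "y - x = v" using dom by blast
    obtain n :: nat where n: "max (max a b) (max (norm x) (norm y)) \<le> real n"
      using real_arch_simple by blast
    have "F y \<le> ereal (real n)" "H x \<le> ereal (real n)"
      using order_trans[OF v(1), of "ereal (real n)"] order_trans[OF v(2), of "ereal (real n)"] n by simp_all
    then have "(y, x) \<in> C n" using n by (simp add: C_def)
    then have "v \<in> (\<lambda>p. fst p - snd p) ` C n" using v(3) by (intro image_eqI[of _ _ "(y, x)"]) auto
    then show "v \<in> (\<Union>n. (\<lambda>p. fst p - snd p) ` C n)" by blast
  qed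
  moreover have "closed (C n)" for n
    using F(2) H(2) unfolding C_def lsc_fun_def by (intro closed_Times closed_Int closed_cball) auto
  moreover have "convex (C n)" for n
    using F(1) H(1) unfolding C_def by (intro convex_Times convex_Int convex_cball convex_sublevel)
  moreover have "bounded (C n)" for n
    unfolding C_def by (intro bounded_Times bounded_Int disjI2 bounded_cball)
  ultimately obtain n \<rho> where \<rho>: "0 < \<rho>" and ball: "ball 0 \<rho> \<subseteq> (\<lambda>p. fst p - snd p) ` C n"
    using ball_in_linear_image[OF T, of C] by metis
  obtain B where B: "\<And>x. norm (M x) \<le> norm x * B" "0 < B"
    using M.pos_bounded by metis
  \<comment> \<open>On the small ball \<open>v = y - x\<close> with heights and norms at most
    \<open>n\<close>, so \<open>le\<close> bounds \<open>L v\<close> by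
    \<open>2 * n - M y - c\<close>.\<close>
  define K where "K = 2 * real n + real n * B + \<bar>c\<bar>"
  have upper: "L v \<le> K" if v: "norm v < \<rho>" for v
  proof -
    have "v \<in> ball 0 \<rho>" using v by simp
    then obtain p where "p \<in> C n" "v = fst p - snd p" using ball by blast
    then obtain y x where yx: "(y, x) \<in> C n" "v = y - x" by (cases p) auto
    then have "L v \<le> real n + real n - M y - c"
      using le[of y "real n" x "real n"] by (simp add: C_def)
    moreover have "\<bar>M y\<bar> \<le> real n * B"
    proof -
      have "norm y \<le> real n" using yx by (simp add: C_def)
      then have "norm y * B \<le> real n * B" using B(2) by (intro mult_right_mono) auto
      then show ?thesis using B(1)[of y] by simp
    qed
    ultimately show ?thesis unfolding K_def by linarith
  qed
  \<comment> \<open>Rescaling to norm \<open>\<rho> / 2\<close> extends the one-sided bound to all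
    vectors; applying it to \<open>- x\<close> as well makes it two-sided.\<close>
  have bound: "L x \<le> norm x * (2 * K / \<rho>)" for x
  proof (cases "x = 0")
    case True
    then show ?thesis using linear_0[OF L] by simp
  next
    case False
    then have "L ((\<rho> / (2 * norm x)) *\<^sub>R x) \<le> K" using \<rho> by (intro upper) simp
    then have "\<rho> / (2 * norm x) * L x \<le> K" by (simp add: linear_scale[OF L])
    then show ?thesis using False \<rho> by (simp add: field_simps)
  qed
  have "norm (L x) \<le> norm x * (2 * K / \<rho>)" for x
    using bound[of x] bound[of "- x"] linear_neg[OF L, of x] by simp
  then have "bounded_linear L"
    by (rule bounded_linear_intro[OF linear_add[OF L] linear_scale[OF L]])
  then show thesis using le by (rule that)
qed

subsection \<open>BC-functions\<close>

lemma bracket_add_right: "bracket p (r + s) = bracket p r + bracket p s"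
  by (simp add: bracket_def blinfun.add_left blinfun.add_right)

lemma bracket_diff_left: "bracket (p - r) s = bracket p s - bracket r s"
  by (simp add: bracket_def blinfun.diff_left blinfun.diff_right)

lemma bracket_self: "bracket p p = 2 * q_fun p"
  by (simp add: bracket_def q_fun_def)

lemma q_fun_add: "q_fun (p + r) = q_fun p + bracket r p + q_fun r"
  by (simp add: bracket_def q_fun_def blinfun.add_left blinfun.add_right)

lemma bounded_linear_bracket: "bounded_linear (\<lambda>p. bracket p r)"
  unfolding bracket_def
  by (intro bounded_linear_add bounded_linear_compose[OF blinfun.bounded_linear_right bounded_linear_fst]
      bounded_linear_compose[OF blinfun.bounded_linear_left bounded_linear_snd])

text \<open>The restriction of \<open>L\<close> to the first factor is a dual vector. Its
  restriction to the second lies in the bidual and is evaluation at a point by reflexivity.\<close>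

lemma reflexive_bracket_representation:
  fixes L :: "'a::real_normed_vector \<times> ('a \<Rightarrow>\<^sub>L real) \<Rightarrow> real"
  assumes refl: "reflexive_space TYPE('a)" and L: "bounded_linear L"
  obtains z where "\<And>p. L p = bracket p z"
proof -
  have L1: "bounded_linear (\<lambda>x. L (x, 0))" and L2: "bounded_linear (\<lambda>xs. L (0, xs))"
    by (auto intro!: bounded_linear_compose[OF L] bounded_linear_Pair bounded_linear_ident bounded_linear_zero)
  obtain x where x: "blinfun_apply (Blinfun (\<lambda>xs. L (0, xs))) xs = blinfun_apply xs x" for xs
    using refl unfolding reflexive_space_def by blast
  have "L p = bracket p (x, Blinfun (\<lambda>x. L (x, 0)))" for p
  proof -
    have "L p = L (fst p, 0) + L (0, snd p)"
      using linear_add[OF bounded_linear.linear[OF L], of "(fst p, 0)" "(0, snd p)"] by simp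
    then show ?thesis
      using x[of "snd p"] by (simp add: bracket_def bounded_linear_Blinfun_apply[OF L1]
          bounded_linear_Blinfun_apply[OF L2])
  qed
  then show thesis by (rule that)
qed

text \<open>Points with \<open>k p = \<infinity>\<close> contribute \<open>-\<infinity>\<close> to
  the supremum, so only real upper bounds of \<open>k\<close> need testing.\<close>

lemma at_conj_le:
  assumes "\<And>p a. k p \<le> ereal a \<Longrightarrow> bracket p r - a \<le> c" and "\<And>p. k p \<noteq> -\<infinity>"
  shows "at_conj k r \<le> ereal c"
  unfolding at_conj_def
proof (rule SUP_least)
  fix p
  show "ereal (bracket p r) - k p \<le> ereal c"
    using assms(1)[of p "real_of_ereal (k p)"] assms(2)[of p] by (cases "k p") auto
qed

theorem Pq_anti_isometry:
  fixes f g :: "'a::banach \<times> ('a \<Rightarrow>\<^sub>L real) \<Rightarrow> ereal"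
  assumes refl: "reflexive_space TYPE('a)"
    and f: "BC_fun f" "lsc_fun f" and g: "BC_fun g" "lsc_fun g"
    and s: "bounded_linear s" "surj s" "\<And>p r. bracket (s p) (s r) = - bracket p r"
    and domains: "\<And>v. \<exists>p r. f p \<noteq> \<infinity> \<and> g (s r) \<noteq> \<infinity> \<and> p - r = v"
  shows "\<exists>z. z + u \<in> Pq f \<and> s z \<in> Pq g"
proof -
  interpret s: bounded_linear s by (rule s(1))
  have fq: "ereal (q_fun p) \<le> f p" and fconj: "f p \<le> at_conj f p" and fninf: "f p \<noteq> -\<infinity>"
    and gq: "ereal (q_fun p) \<le> g p" and gconj: "g p \<le> at_conj g p" and gninf: "g p \<noteq> -\<infinity>" for p
    using f(1) g(1) unfolding BC_fun_def proper_fun_def by blast+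
  have qs: "q_fun (s p) = - q_fun p" for p
    using s(3)[of p p] by (simp add: bracket_self)
  define h where "h p = g (s (p - u))" for p
  have "convex_fun h"
    unfolding convex_fun_def
  proof (intro allI impI)
    fix x y and t :: real assume t: "0 < t \<and> t < 1"
    have "s (t *\<^sub>R x + (1 - t) *\<^sub>R y - u) = t *\<^sub>R s (x - u) + (1 - t) *\<^sub>R s (y - u)"
      by (simp add: s.add s.diff s.scaleR algebra_simps)
    then show "h (t *\<^sub>R x + (1 - t) *\<^sub>R y) \<le> ereal t * h x + ereal (1 - t) * h y"
      using g(1) t unfolding h_def BC_fun_def convex_fun_def by metis
  qed
  have "lsc_fun h"
    unfolding lsc_fun_def
  proof
    fix c :: real
    have "closed ((\<lambda>p. s (p - u)) -` {p. g p \<le> ereal c})"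
      using g(2) by (intro closed_vimage s.continuous_on continuous_intros) (auto simp: lsc_fun_def)
    then show "closed {p. h p \<le> ereal c}" by (simp add: h_def vimage_def)
  qed
  \<comment> \<open>Since \<open>s\<close> reverses the sign of \<open>q_fun\<close>, the quadratic
    parts of the two lower bounds cancel and an affine function of \<open>p\<close> remains.\<close>
  have below: "bracket p u + - q_fun u \<le> a + b" if "f p \<le> ereal a" "h p \<le> ereal b" for p a b
  proof -
    have "q_fun p \<le> a" using order_trans[OF fq that(1)] by simp
    moreover have "- q_fun (p - u) \<le> b"
      using order_trans[OF gq that(2)[unfolded h_def]] by (simp add: qs)
    moreover have "q_fun p - q_fun (p - u) = bracket p u - q_fun u"
      by (simp add: bracket_def q_fun_def blinfun.diff_left blinfun.diff_right)
    ultimately show ?thesis by simp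
  qed
  have "\<exists>x y. f y \<noteq> \<infinity> \<and> h x \<noteq> \<infinity> \<and> y - x = v" for v
  proof -
    obtain p r where "f p \<noteq> \<infinity>" "g (s r) \<noteq> \<infinity>" "p - r = v + u" using domains by blast
    then show ?thesis
      by (intro exI[of _ "r + u"] exI[of _ p]) (simp add: h_def algebra_simps)
  qed
  then obtain L where "bounded_linear L"
    and L: "\<And>x y a b. f y \<le> ereal a \<Longrightarrow> h x \<le> ereal b \<Longrightarrow> L (y - x) + bracket y u + - q_fun u \<le> a + b"
    using fenchel_separation[of f h "\<lambda>p. bracket p u" "- q_fun u"] f below
      \<open>convex_fun h\<close> \<open>lsc_fun h\<close> bounded_linear_bracket[of u] unfolding BC_fun_def by metis
  then obtain z where z: "L p = bracket p z" for p
    using reflexive_bracket_representation[OF refl] by metis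
  \<comment> \<open>With \<open>x = r + u\<close> the separation inequality splits: the left side is
    a term of the supremum \<open>at_conj f (z + u)\<close>, and the right side is free of
    \<open>y\<close>.\<close>
  have sep: "bracket y (z + u) - a \<le> b + bracket r z + bracket u z + q_fun u"
    if "f y \<le> ereal a" "g (s r) \<le> ereal b" for y r a b
    using L[of y a "r + u" b] that
    by (simp add: h_def z bracket_add_right bracket_diff_left[of y "r + u"] bracket_def
        blinfun.add_left blinfun.add_right blinfun.diff_left blinfun.diff_right)
  have f_le: "f (z + u) \<le> ereal (b + bracket r z + bracket u z + q_fun u)" if "g (s r) \<le> ereal b" for r b
    using sep[OF _ that] by (intro order_trans[OF fconj] at_conj_le fninf)
  \<comment> \<open>One finite value of \<open>g\<close> makes \<open>f (z + u)\<close> real, so it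
    can be moved across the inequality.\<close>
  obtain r where "g (s r) \<noteq> \<infinity>" using domains by blast
  then have "g (s r) \<le> ereal (real_of_ereal (g (s r)))" using gninf[of "s r"] by (cases "g (s r)") auto
  then have "f (z + u) \<noteq> \<infinity>" using f_le[of r] by fastforce
  then obtain \<alpha> where \<alpha>: "f (z + u) = ereal \<alpha>" using fninf by (cases "f (z + u)") auto
  \<comment> \<open>Now \<open>r\<close> varies: by surjectivity \<open>s r\<close> runs through all
    points, and \<open>bracket (s r) (s z)\<close> is \<open>- bracket r z\<close>.\<close>
  have "g (s z) \<le> ereal (bracket u z + q_fun u - \<alpha>)"
  proof (intro order_trans[OF gconj] at_conj_le gninf)
    fix p a assume "g p \<le> ereal a"
    moreover obtain r where r: "p = s r" using s(2) by blast
    ultimately show "bracket p (s z) - a \<le> bracket u z + q_fun u - \<alpha>"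
      using f_le[of r a] by (simp add: \<alpha> s(3))
  qed
  moreover have "q_fun (z + u) = q_fun z + bracket u z + q_fun u" by (rule q_fun_add)
  moreover have "q_fun (z + u) \<le> \<alpha>" using fq[of "z + u"] by (simp add: \<alpha>)
  moreover have "ereal (- q_fun z) \<le> g (s z)" using gq[of "s z"] by (simp add: qs)
  \<comment> \<open>The upper bound for the sum of both values is
    \<open>q_fun (z + u) - q_fun z\<close>, exactly the sum of their lower bounds, so both are
    attained.\<close>
  ultimately have "\<alpha> = q_fun (z + u)" "g (s z) = ereal (- q_fun z)"
    by (cases "g (s z)"; simp)+
  then show ?thesis by (intro exI[of _ z]) (simp add: Pq_def \<alpha> qs)
qed

theorem theorem7p4:
  fixes f g :: "'a::banach \<times> ('a \<Rightarrow>\<^sub>L real) \<Rightarrow> ereal"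
    and w :: "'a \<Rightarrow>\<^sub>L real"
  assumes "\<exists>x::'a. x \<noteq> 0"
    and "reflexive_space TYPE('a)"
    and "proper_fun f" "convex_fun f" "lsc_fun f" "BC_fun f"
    and "proper_fun g" "convex_fun g" "lsc_fun g" "BC_fun g"
    and "\<forall>x. (x, w) \<in> dom_fun f"
    and "snd ` dom_fun g = UNIV"
  shows "({p + rho1 r | p r. p \<in> Pq f \<and> r \<in> Pq g} = UNIV
       \<and> {p - rho1 r | p r. p \<in> Pq f \<and> r \<in> Pq g} = UNIV)
     \<and> (\<forall>x. \<exists>y z ys. (y, ys) \<in> Pq f \<and> (z, ys) \<in> Pq g \<and> y + z = x)
     \<and> (\<forall>xs. \<exists>y ys zs. (y, ys) \<in> Pq f \<and> (y, zs) \<in> Pq g \<and> ys + zs = xs)"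
proof -
  have fdom: "f (x, w) \<noteq> \<infinity>" for x
    using assms(11) by (simp add: dom_fun_def)
  have gdom: "\<exists>x. g (x, xs) \<noteq> \<infinity>" for xs
  proof -
    have "xs \<in> snd ` dom_fun g" using assms(12) by simp
    then show ?thesis by (auto simp: dom_fun_def)
  qed
  \<comment> \<open>Negating the second coordinate gives \<open>rho1 (s z) = - z\<close>, hence the
    decomposition of \<open>u\<close> as a sum.\<close>
  have "\<exists>z. z + u \<in> Pq f \<and> (fst z, - snd z) \<in> Pq g" for u
  proof (rule Pq_anti_isometry)
    show "bounded_linear (\<lambda>p::'a \<times> ('a \<Rightarrow>\<^sub>L real). (fst p, - snd p))"
      by (intro bounded_linear_Pair bounded_linear_minus bounded_linear_fst bounded_linear_snd)
    show "surj (\<lambda>p::'a \<times> ('a \<Rightarrow>\<^sub>L real). (fst p, - snd p))"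
      by (rule surjI[where f = "\<lambda>p. (fst p, - snd p)"]) simp
    show "bracket (fst p, - snd p) (fst r, - snd r) = - bracket p r" for p r :: "'a \<times> ('a \<Rightarrow>\<^sub>L real)"
      by (simp add: bracket_def blinfun.minus_left)
    show "\<exists>p r. f p \<noteq> \<infinity> \<and> g (fst r, - snd r) \<noteq> \<infinity> \<and> p - r = v" for v
    proof -
      \<comment> \<open>The second coordinate of \<open>p\<close> is fixed at \<open>w\<close>,
        which determines that of \<open>r\<close>. The free first coordinate of \<open>p\<close>
        then compensates for whatever \<open>x\<close> occurs.\<close>
      obtain x where "g (x, snd v - w) \<noteq> \<infinity>" using gdom by blast
      then show ?thesis using fdom[of "x + fst v"]
        by (intro exI[of _ "(x + fst v, w)"] exI[of _ "(x, w - snd v)"]) (simp add: prod_eq_iff)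
    qed
  qed (use assms in auto)
  then have add: "\<exists>y ys z zs. (y, ys) \<in> Pq f \<and> (z, zs) \<in> Pq g \<and> y - z = a \<and> ys + zs = b" for a b
  proof -
    obtain z where "z + (a, b) \<in> Pq f" "(fst z, - snd z) \<in> Pq g"
      using \<open>\<And>u. \<exists>z. z + u \<in> Pq f \<and> (fst z, - snd z) \<in> Pq g\<close> by blast
    then have "(fst z + a, snd z + b) \<in> Pq f" "(fst z, - snd z) \<in> Pq g"
      by (simp_all add: plus_prod_def)
    then show ?thesis by fastforce
  qed
  \<comment> \<open>Here \<open>s\<close> is \<open>rho1\<close> itself, so
    \<open>rho1 (s z) = z\<close> and \<open>u\<close> becomes a difference.\<close>
  have "\<exists>z. z + u \<in> Pq f \<and> (- fst z, snd z) \<in> Pq g" for u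
  proof (rule Pq_anti_isometry)
    show "bounded_linear (\<lambda>p::'a \<times> ('a \<Rightarrow>\<^sub>L real). (- fst p, snd p))"
      by (intro bounded_linear_Pair bounded_linear_minus bounded_linear_fst bounded_linear_snd)
    show "surj (\<lambda>p::'a \<times> ('a \<Rightarrow>\<^sub>L real). (- fst p, snd p))"
      by (rule surjI[where f = "\<lambda>p. (- fst p, snd p)"]) simp
    show "bracket (- fst p, snd p) (- fst r, snd r) = - bracket p r" for p r :: "'a \<times> ('a \<Rightarrow>\<^sub>L real)"
      by (simp add: bracket_def blinfun.minus_right)
    show "\<exists>p r. f p \<noteq> \<infinity> \<and> g (- fst r, snd r) \<noteq> \<infinity> \<and> p - r = v" for v
    proof -
      obtain x where "g (x, w - snd v) \<noteq> \<infinity>" using gdom by blast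
      then show ?thesis using fdom[of "fst v - x"]
        by (intro exI[of _ "(fst v - x, w)"] exI[of _ "(- x, w - snd v)"]) (simp add: prod_eq_iff)
    qed
  qed (use assms in auto)
  then have diff: "\<exists>y ys z zs. (y, ys) \<in> Pq f \<and> (z, zs) \<in> Pq g \<and> y + z = a \<and> ys - zs = b" for a b
  proof -
    obtain z where "z + (a, b) \<in> Pq f" "(- fst z, snd z) \<in> Pq g"
      using \<open>\<And>u. \<exists>z. z + u \<in> Pq f \<and> (- fst z, snd z) \<in> Pq g\<close> by blast
    then have "(fst z + a, snd z + b) \<in> Pq f" "(- fst z, snd z) \<in> Pq g"
      by (simp_all add: plus_prod_def)
    then show ?thesis by fastforce
  qed
  have "u \<in> {p + rho1 r | p r. p \<in> Pq f \<and> r \<in> Pq g}" for u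
  proof -
    obtain y ys z zs where "(y, ys) \<in> Pq f" "(z, zs) \<in> Pq g" "u = (y, ys) + rho1 (z, zs)"
      using add[of "fst u" "snd u"] by (auto simp: rho1_def prod_eq_iff)
    then show ?thesis by blast
  qed
  moreover have "u \<in> {p - rho1 r | p r. p \<in> Pq f \<and> r \<in> Pq g}" for u
  proof -
    obtain y ys z zs where "(y, ys) \<in> Pq f" "(z, zs) \<in> Pq g" "u = (y, ys) - rho1 (z, zs)"
      using diff[of "fst u" "snd u"] by (auto simp: rho1_def prod_eq_iff)
    then show ?thesis by blast
  qed
  \<comment> \<open>A zero second coordinate in \<open>diff\<close> forces equal dual parts; a zero
    first coordinate in \<open>add\<close> below forces equal primal parts.\<close>
  moreover have "\<exists>y z ys. (y, ys) \<in> Pq f \<and> (z, ys) \<in> Pq g \<and> y + z = x" for x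
    using diff[of x 0] by auto
  moreover have "\<exists>y ys zs. (y, ys) \<in> Pq f \<and> (y, zs) \<in> Pq g \<and> ys + zs = xs" for xs
    using add[of 0 xs] by auto
  ultimately show ?thesis by blast
qed

end
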